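(* For any differential operator of first order $L\in\mathit{Vect}(n)$ and for any non-negative integer $m$, $$L^m=Y_m^\bullet (L,\;L\circ L,\;\ldots,\;L^{m-1}\circ L),$$ where $L^m=L\diamond\cdots\diamond L$ ($m$ factors) is the power of $L$ under composition and $Y_m^\bullet(L,L\circ L,\ldots,L^{m-1}\circ L)$ is the Bell polynomial $Y_m(x_1,\dots,x_m)$ evaluated at $x_i= L^{i-1}\circ L$, $i=1,\dots,m$, with all products and powers of the variables taken with respect to the associative commutative multiplication $\bullet$.
   Context: Let $U$ be the coefficient algebra: a commutative associative unital $\mathbf{C}$-algebra of functions $u=u(x_1,\ldots,x_n)$ with the commuting $\mathbf{C}$-linear derivations $\partial_i=\partial/\partial x_i$, $i=1,\dots,n$ (only this differential-algebra structure is used; for example $U=\mathbf{C}[[x_1,\ldots,x_n]]$). For $\alpha=(\alpha_1,\dots,\alpha_n)\in\mathbf{Z}_0^n$ ($\mathbf{Z}_0$ = non-negative integers) put $\partial^\alpha=\prod_{i=1}^n\partial_i^{\alpha_i}$. $\mathit{Diff}_n$ is the space of differential operators, i.e. finite formal sums $\sum_{\alpha\in\mathbf{Z}_0^n}u_\alpha\partial^\alpha$ with $u_\alpha\in U$ (the free $U$-module on the symbols $\partial^\alpha$). $\mathit{Vect}(n)$ is the subspace of differential operators of first order, i.e. those of the form $\sum_{i=1}^n u_i\partial_i$ with $u_i\in U$. Three bilinear multiplications on $\mathit{Diff}_n$ are defined on generators by $$u\partial^\alpha \diamond v \partial^\beta=\sum_{\gamma\in \mathbf{Z}^n_0} \binom{\alpha}{\gamma}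 u\,\partial^\gamma(v)\,\partial^{\alpha+\beta-\gamma},\qquad u\partial^\alpha\circ v\partial^\beta=u\,\partial^\alpha(v)\,\partial^\beta,\qquad u\partial^\alpha \bullet v\partial^\beta= u v\, \partial^{\alpha+\beta},$$ where $\binom{\alpha}{\gamma}=\prod_i\binom{\alpha_i}{\gamma_i}$ (zero unless $\gamma\le\alpha$ componentwise) and $\partial^\alpha(v)$ is the iterated derivative of $v$. The multiplication $\diamond$ is associative and $\bullet$ is associative and commutative; the identity operator $1=\partial^0$ is the unit for both, and $L^0=1$, so $L^0\circ L=L$. The Bell polynomial is $$Y_m(x_1,\ldots,x_m)=\sum \frac{m!}{l_1!\, l_2! \cdots l_m!\; 1!^{l_1} 2!^{l_2}\cdots m!^{l_m}}\; x_1^{l_1}\cdots x_m^{l_m},$$ the sum being over all sequences of non-negative integers $(l_1,\dots,l_m)$ with $1\,l_1+2\,l_2+\cdots+m\,l_m=m$; $Y_0=1$. *)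

theory Defs
  imports Complex_Main "HOL-Library.Poly_Mapping" "HOL-Library.Function_Algebras" "HOL-Library.FuncSet"
begin

locale comm_diff_algebra =
  vector_space scale
  for scale :: "complex \<Rightarrow> 'u::comm_ring_1 \<Rightarrow> 'u" +
  fixes D :: "'n::finite \<Rightarrow> 'u \<Rightarrow> 'u"
  assumes scale_mult_left: "scale c (u * v) = scale c u * v"
    and D_linear: "Vector_Spaces.linear scale scale (D i)"
    and D_leibniz: "D i (u * v) = D i u * v + u * D i v"
    and D_commute: "D i (D j u) = D j (D i u)"

(* The fold is independent of the order of the indices because the D i commute;
   see dpow_eq_fold_list below. *)
definition dpow :: "('n::finite \<Rightarrow> 'u \<Rightarrow> 'u) \<Rightarrow> ('n \<Rightarrow> nat) \<Rightarrow> 'u \<Rightarrow> 'u" where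
  "dpow D \<alpha> v = Finite_Set.fold (\<lambda>i. D i ^^ \<alpha> i) v UNIV"

(* The free U-module on the symbols \<partial>^\<alpha>; Poly_Mapping.single \<alpha> u stands for u \<partial>^\<alpha>.
   Multi-indices are added, subtracted and compared componentwise.  The ring product and
   the unit of this poly_mapping type are the multiplication \<bullet> and the
   identity operator \<partial>^0; see bullet_single below. *)
type_synonym ('n, 'u) diffop = "('n \<Rightarrow> nat) \<Rightarrow>\<^sub>0 'u"

definition diffop_scale ::
    "(complex \<Rightarrow> 'u \<Rightarrow> 'u) \<Rightarrow> complex \<Rightarrow> ('n::finite, 'u::comm_ring_1) diffop \<Rightarrow> ('n, 'u) diffop" where
  "diffop_scale scale c = Poly_Mapping.map (scale c)"

definition unit_index :: "'n \<Rightarrow> ('n \<Rightarrow> nat)" where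
  "unit_index i = (\<lambda>j. if j = i then 1 else 0)"

definition Vect :: "('n::finite, 'u::comm_ring_1) diffop set" where
  "Vect = {L. \<exists>u :: 'n \<Rightarrow> 'u. L = (\<Sum>i\<in>UNIV. Poly_Mapping.single (unit_index i) (u i))}"

definition multi_binomial :: "('n::finite \<Rightarrow> nat) \<Rightarrow> ('n \<Rightarrow> nat) \<Rightarrow> nat" where
  "multi_binomial \<alpha> \<gamma> = (\<Prod>i\<in>UNIV. \<alpha> i choose \<gamma> i)"

(* The multiplication \<diamond>, extended bilinearly from the generators.  Only the finitely many
   \<gamma> \<le> \<alpha> have a non-zero binomial coefficient. *)
definition dcomp ::
    "('n::finite \<Rightarrow> 'u \<Rightarrow> 'u) \<Rightarrow> ('n, 'u::comm_ring_1) diffop \<Rightarrow> ('n, 'u) diffop \<Rightarrow> ('n, 'u) diffop" where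
  "dcomp D P Q =
    (\<Sum>\<alpha>\<in>Poly_Mapping.keys P. \<Sum>\<beta>\<in>Poly_Mapping.keys Q. \<Sum>\<gamma> | \<gamma> \<le> \<alpha>.
      Poly_Mapping.single (\<alpha> + \<beta> - \<gamma>)
        (of_nat (multi_binomial \<alpha> \<gamma>) * Poly_Mapping.lookup P \<alpha> * dpow D \<gamma> (Poly_Mapping.lookup Q \<beta>)))"

(* The multiplication \<circ>, extended bilinearly from the generators. *)
definition dcirc ::
    "('n::finite \<Rightarrow> 'u \<Rightarrow> 'u) \<Rightarrow> ('n, 'u::comm_ring_1) diffop \<Rightarrow> ('n, 'u) diffop \<Rightarrow> ('n, 'u) diffop" where
  "dcirc D P Q =
    (\<Sum>\<alpha>\<in>Poly_Mapping.keys P. \<Sum>\<beta>\<in>Poly_Mapping.keys Q.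
      Poly_Mapping.single \<beta> (Poly_Mapping.lookup P \<alpha> * dpow D \<alpha> (Poly_Mapping.lookup Q \<beta>)))"

definition dcomp_power ::
    "('n::finite \<Rightarrow> 'u \<Rightarrow> 'u) \<Rightarrow> ('n, 'u::comm_ring_1) diffop \<Rightarrow> nat \<Rightarrow> ('n, 'u) diffop" where
  "dcomp_power D L m = (dcomp D L ^^ m) 1"

(* A sequence (l_1, ..., l_m) is a function on nat vanishing outside {1..m}. *)
definition bell_indices :: "nat \<Rightarrow> (nat \<Rightarrow> nat) set" where
  "bell_indices m = {l. (\<forall>i. i \<notin> {1..m} \<longrightarrow> l i = 0) \<and> (\<Sum>i=1..m. i * l i) = m}"

(* Y_m evaluated in a commutative complex algebra with scalar multiplication sc. *)
definition bell ::
    "(complex \<Rightarrow> 'a \<Rightarrow> 'a) \<Rightarrow> nat \<Rightarrow> (nat \<Rightarrow> 'a) \<Rightarrow> 'a::comm_ring_1" where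
  "bell sc m x =
    (\<Sum>l\<in>bell_indices m.
      sc (fact m / ((\<Prod>i=1..m. fact (l i)) * (\<Prod>i=1..m. fact i ^ l i))) (\<Prod>i=1..m. x i ^ l i))"

lemma finite_multi_index_le: "finite {\<gamma> :: 'n::finite \<Rightarrow> nat. \<gamma> \<le> \<alpha>}"
proof (rule finite_subset)
  show "{\<gamma>. \<gamma> \<le> \<alpha>} \<subseteq> (PiE UNIV (\<lambda>i. {..\<alpha> i}))"
    by (auto simp: le_fun_def PiE_def Pi_def extensional_def)
  show "finite (PiE UNIV (\<lambda>i. {..\<alpha> i}))"
    by (intro finite_PiE) auto
qed

lemma finite_bell_indices: "finite (bell_indices m)"
proof (rule finite_subset)
  show "bell_indices m \<subseteq> {l. \<forall>i. (i \<in> {1..m} \<longrightarrow> l i \<in> {..m}) \<and> (i \<notin> {1..m} \<longrightarrow> l i = 0)}"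
  proof (intro subsetI CollectI allI conjI impI)
    fix l i assume l: "l \<in> bell_indices m"
    {
      assume i: "i \<in> {1..m}"
      have "l i \<le> i * l i" using i by simp
      also have "\<dots> \<le> (\<Sum>i=1..m. i * l i)"
        using i by (intro member_le_sum[where f = "\<lambda>i. i * l i"]) auto
      also have "\<dots> = m" using l by (simp add: bell_indices_def)
      finally show "l i \<in> {..m}" by simp
    next
      assume "i \<notin> {1..m}"
      then show "l i = 0" using l by (simp add: bell_indices_def)
    }
  qed
  show "finite {l. \<forall>i. (i \<in> {1..m} \<longrightarrow> l i \<in> {..m}) \<and> (i \<notin> {1..m} \<longrightarrow> l i = (0::nat))}"
    by (intro finite_set_of_finite_funs) auto
qed

lemma bullet_single:
  "Poly_Mapping.single \<alpha> u * Poly_Mapping.single \<beta> v =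
    (Poly_Mapping.single (\<alpha> + \<beta>) (u * v) :: ('n::finite, 'u::comm_ring_1) diffop)"
  by (rule mult_single)

lemma Poly_Mapping_one: "(1 :: ('n::finite, 'u::comm_ring_1) diffop) = Poly_Mapping.single 0 1"
  by simp

context comm_diff_algebra
begin

lemma D_zero [simp]: "D i 0 = 0"
  using D_leibniz[of i 0 0] by simp

lemma funpow_D_zero [simp]: "(D i ^^ k) 0 = 0"
  by (induction k) auto

lemma funpow_D_commute: "(D i ^^ k) ((D j ^^ l) v) = (D j ^^ l) ((D i ^^ k) v)"
proof -
  have 1: "(D i ^^ k) (D j v) = D j ((D i ^^ k) v)" for k v
    by (induction k) (simp_all add: D_commute[of i j])
  show ?thesis
    by (induction l) (simp_all add: 1)
qed

lemma comp_fun_commute_funpow_D: "comp_fun_commute (\<lambda>i. D i ^^ \<alpha> i)"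
  by standard (simp add: fun_eq_iff funpow_D_commute)

lemma dpow_eq_fold_list:
  assumes "distinct is" "set is = UNIV"
  shows "dpow D \<alpha> v = List.fold (\<lambda>i. D i ^^ \<alpha> i) is v"
proof -
  interpret comp_fun_commute "\<lambda>i. D i ^^ \<alpha> i"
    by (rule comp_fun_commute_funpow_D)
  show ?thesis
    using fold_set_fold_remdups[of v "is"] assms by (simp add: dpow_def distinct_remdups_id)
qed

lemma dpow_zero [simp]: "dpow D \<alpha> 0 = 0"
proof -
  obtain ns :: "'n list" where ns: "set ns = UNIV" "distinct ns"
    using finite_distinct_list[OF finite_UNIV] by blast
  have "List.fold (\<lambda>i. D i ^^ \<alpha> i) js 0 = 0" for js
    by (induction js) auto
  then show ?thesis
    using dpow_eq_fold_list[OF ns(2,1)] by simp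
qed

lemma dcomp_single:
  fixes \<alpha> \<beta> :: "'n \<Rightarrow> nat"
  shows "dcomp D (Poly_Mapping.single \<alpha> u) (Poly_Mapping.single \<beta> v) =
    (\<Sum>\<gamma> | \<gamma> \<le> \<alpha>. Poly_Mapping.single (\<alpha> + \<beta> - \<gamma>)
      (of_nat (multi_binomial \<alpha> \<gamma>) * u * dpow D \<gamma> v))"
  by (cases "u = 0"; cases "v = 0") (simp_all add: dcomp_def)

lemma dcirc_single:
  fixes \<alpha> \<beta> :: "'n \<Rightarrow> nat"
  shows "dcirc D (Poly_Mapping.single \<alpha> u) (Poly_Mapping.single \<beta> v) =
    Poly_Mapping.single \<beta> (u * dpow D \<alpha> v)"
  by (cases "u = 0"; cases "v = 0") (simp_all add: dcirc_def)

end

end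

theory Submission
  imports Defs
begin

text \<open>
  For \<open>L = \<Sum>\<^sub>i u\<^sub>i \<partial>\<^sub>i\<close> put \<open>\<delta> P = L \<circ> P\<close>. This applies the derivation \<open>\<Sum>\<^sub>i u\<^sub>i \<partial>\<^sub>i\<close> of \<open>U\<close> to the
  coefficients of \<open>P\<close>, so \<open>\<delta>\<close> is a derivation of the commutative algebra of differential operators
  under \<open>\<bullet>\<close> (lemma \<open>dcirc_Vect_leibniz\<close>). The Leibniz rule in the definition of \<open>\<diamond>\<close> has only two terms
  when the left factor has first order, which gives \<open>L \<diamond> P = L \<bullet> P + \<delta> P\<close> (lemma \<open>dcomp_Vect\<close>).
  Moreover \<open>\<circ>\<close> is an action: \<open>(L \<diamond> P) \<circ> Q = \<delta> (P \<circ> Q)\<close> (lemma \<open>dcirc_dcomp_Vect\<close>); hence the elements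
  \<open>x\<^sub>i = L\<^bsup>i-1\<^esup> \<circ> L\<close> satisfy \<open>x\<^sub>1 = L\<close> and \<open>\<delta> x\<^sub>i = x\<^bsub>i+1\<^esub>\<close>.

  In any commutative algebra with a derivation \<open>\<delta>\<close> such that \<open>\<delta> x\<^sub>i = x\<^bsub>i+1\<^esub>\<close>, the Bell polynomials obey
  \<open>Y\<^bsub>m+1\<^esub> = x\<^sub>1 Y\<^sub>m + \<delta> Y\<^sub>m\<close> (lemma \<open>bell_Suc\<close>). The powers \<open>L\<^sup>m\<close> obey the same recurrence and both
  sequences start at 1, so they agree.

  For the recurrence, write \<open>Y\<^sub>m = m! \<Sum>\<^sub>l T(l)\<close> with
  \<open>T(l) = \<Prod>\<^sub>i x\<^sub>i\<^bsup>l\<^sub>i\<^esup> / (l\<^sub>i! i!\<^bsup>l\<^sub>i\<^esup>)\<close>. Multiplying \<open>T(l)\<close> by \<open>x\<^sub>1\<close> raises \<open>l\<^sub>1\<close> by one, and each term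
  of \<open>\<delta> T(l)\<close> moves one unit from some \<open>l\<^sub>i\<close> to \<open>l\<^bsub>i+1\<^esub>\<close>. If \<open>l'\<close> results from such a step raising \<open>l\<^sub>j\<close>,
  the new term is \<open>j l'\<^sub>j T(l')\<close>. For each \<open>j\<close>, every \<open>l'\<close> of weight \<open>m + 1\<close> with \<open>l'\<^sub>j > 0\<close> arises
  exactly once, so \<open>T(l')\<close> is collected with total coefficient \<open>\<Sum>\<^sub>j j l'\<^sub>j = m + 1\<close>.
\<close>

section \<open>The recurrence of the Bell polynomials\<close>

text \<open>
  Exponent sequences of weight \<open>m\<close> may be described with any upper bound \<open>N \<ge> m\<close> for the indices, so
  that sequences of weights \<open>m\<close> and \<open>m + 1\<close> can be treated over the same range.
\<close>
lemma bell_indices_iff: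
  assumes "m \<le> N"
  shows "l \<in> bell_indices m \<longleftrightarrow> (\<forall>i. i \<notin> {1..N} \<longrightarrow> l i = 0) \<and> (\<Sum>i=1..N. i * l i) = m"
proof
  assume l: "l \<in> bell_indices m"
  have "(\<Sum>i=1..N. i * l i) = (\<Sum>i=1..m. i * l i)"
    using l assms by (intro sum.mono_neutral_right) (auto simp: bell_indices_def)
  then show "(\<forall>i. i \<notin> {1..N} \<longrightarrow> l i = 0) \<and> (\<Sum>i=1..N. i * l i) = m"
    using l assms by (auto simp: bell_indices_def)
next
  assume l: "(\<forall>i. i \<notin> {1..N} \<longrightarrow> l i = 0) \<and> (\<Sum>i=1..N. i * l i) = m"
  have z: "l i = 0" if "i \<notin> {1..m}" for i
  proof (rule ccontr)
    assume "l i \<noteq> 0"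
    then have i: "i \<in> {1..N}" using conjunct1[OF l] by metis
    have "i \<le> i * l i" using \<open>l i \<noteq> 0\<close> by simp
    also have "\<dots> \<le> (\<Sum>i=1..N. i * l i)"
      using i by (intro member_le_sum[where f = "\<lambda>i. i * l i"]) auto
    finally show False using l i that by simp
  qed
  have "(\<Sum>i=1..N. i * l i) = (\<Sum>i=1..m. i * l i)"
    using z assms by (intro sum.mono_neutral_right) auto
  with l z show "l \<in> bell_indices m" by (auto simp: bell_indices_def)
qed

lemma bij_betw_bell_raise:
  "bij_betw (\<lambda>l. l(1 := Suc (l 1))) (bell_indices m) {l \<in> bell_indices (Suc m). l 1 > 0}"
proof (rule bij_betw_byWitness[where f' = "\<lambda>l. l(1 := l 1 - 1)"])
  have mem: "l \<in> bell_indices n \<longleftrightarrow>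
      (\<forall>k. k \<notin> {1..Suc m} \<longrightarrow> l k = 0) \<and> (\<Sum>k=1..Suc m. k * l k) = n" if "n \<le> Suc m" for l n
    using that by (rule bell_indices_iff)
  have split: "(\<Sum>k=1..Suc m. k * l k) = l 1 + (\<Sum>k\<in>{1..Suc m} - {1}. k * l k)" for l :: "nat \<Rightarrow> nat"
    using sum.remove[of "{1..Suc m}" 1 "\<lambda>k. k * l k"] by simp
  have 1: "l(1 := Suc (l 1)) \<in> bell_indices (Suc m)" if "l \<in> bell_indices m" for l
    using that unfolding mem[OF le_SucI[OF order_refl]] mem[OF order_refl] split by auto
  have 2: "l(1 := l 1 - 1) \<in> bell_indices m" if "l \<in> bell_indices (Suc m)" "l 1 > 0" for l
    using that unfolding mem[OF le_SucI[OF order_refl]] mem[OF order_refl] split by auto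
  show "(\<lambda>l. l(1 := Suc (l 1))) ` bell_indices m \<subseteq> {l \<in> bell_indices (Suc m). l 1 > 0}"
    using 1 by auto
  show "(\<lambda>l. l(1 := l 1 - 1)) ` {l \<in> bell_indices (Suc m). l 1 > 0} \<subseteq> bell_indices m"
    using 2 by auto
qed (auto simp: fun_eq_iff)

lemma bij_betw_bell_shift:
  assumes i: "i \<in> {1..m}"
  shows "bij_betw (\<lambda>l. l(i := l i - 1, Suc i := Suc (l (Suc i))))
    {l \<in> bell_indices m. l i > 0} {l \<in> bell_indices (Suc m). l (Suc i) > 0}"
proof (rule bij_betw_byWitness[where f' = "\<lambda>l. l(i := Suc (l i), Suc i := l (Suc i) - 1)"])
  have mem: "l \<in> bell_indices n \<longleftrightarrow>
      (\<forall>k. k \<notin> {1..Suc m} \<longrightarrow> l k = 0) \<and> (\<Sum>k=1..Suc m. k * l k) = n" if "n \<le> Suc m" for l n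
    using that by (rule bell_indices_iff)
  have split: "(\<Sum>k=1..Suc m. k * l k) =
      i * l i + (Suc i * l (Suc i) + (\<Sum>k\<in>{1..Suc m} - {i} - {Suc i}. k * l k))" for l :: "nat \<Rightarrow> nat"
    using i sum.remove[of "{1..Suc m}" i "\<lambda>k. k * l k"]
      sum.remove[of "{1..Suc m} - {i}" "Suc i" "\<lambda>k. k * l k"] by simp
  have *: "(\<Sum>k\<in>{1..Suc m} - {i} - {Suc i}. k * (l(i := a, Suc i := b)) k) =
      (\<Sum>k\<in>{1..Suc m} - {i} - {Suc i}. k * l k)" for l :: "nat \<Rightarrow> nat" and a b
    by (intro sum.cong) auto
  have 1: "l(i := l i - 1, Suc i := Suc (l (Suc i))) \<in> bell_indices (Suc m)"
    if l: "l \<in> bell_indices m" and pos: "l i > 0" for l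
  proof -
    obtain k where k: "l i = Suc k" using pos by (cases "l i") auto
    show ?thesis
      using l i k unfolding mem[OF le_SucI[OF order_refl]] mem[OF order_refl] split * by auto
  qed
  have 2: "l(i := Suc (l i), Suc i := l (Suc i) - 1) \<in> bell_indices m"
    if l: "l \<in> bell_indices (Suc m)" and pos: "l (Suc i) > 0" for l
  proof -
    obtain k where k: "l (Suc i) = Suc k" using pos by (cases "l (Suc i)") auto
    show ?thesis
      using l i k unfolding mem[OF le_SucI[OF order_refl]] mem[OF order_refl] split * by auto
  qed
  show "(\<lambda>l. l(i := l i - 1, Suc i := Suc (l (Suc i)))) ` {l \<in> bell_indices m. l i > 0}
      \<subseteq> {l \<in> bell_indices (Suc m). l (Suc i) > 0}"
    using 1 by auto
  show "(\<lambda>l. l(i := Suc (l i), Suc i := l (Suc i) - 1)) ` {l \<in> bell_indices (Suc m). l (Suc i) > 0}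
      \<subseteq> {l \<in> bell_indices m. l i > 0}"
    using 2 by auto
qed (auto simp: fun_eq_iff)

text \<open>
  A commutative complex algebra, given by its structure homomorphism \<open>h\<close> from the scalars, with a
  derivation \<open>\<delta>\<close> and a sequence \<open>x\<^sub>1, x\<^sub>2, \<dots>\<close> such that \<open>\<delta> x\<^sub>i = x\<^bsub>i+1\<^esub>\<close>. The value \<open>x 0\<close> plays no role.
\<close>
locale derivation_chain =
  fixes h :: "complex \<Rightarrow> 'a::comm_ring_1"
    and \<delta> :: "'a \<Rightarrow> 'a"
    and x :: "nat \<Rightarrow> 'a"
  assumes h_one: "h 1 = 1"
    and h_add: "h (a + b) = h a + h b"
    and h_mult: "h (a * b) = h a * h b"
    and \<delta>_add: "\<delta> (p + q) = \<delta> p + \<delta> q"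
    and \<delta>_leibniz: "\<delta> (p * q) = \<delta> p * q + p * \<delta> q"
    and \<delta>_scalar: "\<delta> (h c) = 0"
    and \<delta>_chain: "i \<ge> 1 \<Longrightarrow> \<delta> (x i) = x (Suc i)"
begin

lemma h_zero: "h 0 = 0"
  using h_add[of 0 0] by simp

lemma h_of_nat: "h (of_nat k) = of_nat k"
  by (induction k) (simp_all add: h_zero h_one h_add)

lemma \<delta>_zero: "\<delta> 0 = 0"
  using \<delta>_add[of 0 0] by simp

lemma \<delta>_one: "\<delta> 1 = 0"
  using \<delta>_scalar[of 1] by (simp add: h_one)

lemma \<delta>_sum: "\<delta> (\<Sum>a\<in>A. f a) = (\<Sum>a\<in>A. \<delta> (f a))"
  by (induction A rule: infinite_finite_induct) (simp_all add: \<delta>_zero \<delta>_add)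

lemma \<delta>_power: "\<delta> (p ^ k) = of_nat k * p ^ (k - 1) * \<delta> p"
proof (induction k)
  case 0
  show ?case by (simp add: \<delta>_one)
next
  case (Suc k)
  then show ?case
    by (cases k) (simp_all add: \<delta>_leibniz algebra_simps)
qed

lemma \<delta>_prod:
  "finite A \<Longrightarrow> \<delta> (\<Prod>a\<in>A. f a) = (\<Sum>a\<in>A. \<delta> (f a) * (\<Prod>b\<in>A - {a}. f b))"
proof (induction A rule: finite_induct)
  case empty
  show ?case by (simp add: \<delta>_one)
next
  case (insert a A)
  have "(\<Sum>c\<in>A. \<delta> (f c) * (\<Prod>b\<in>insert a A - {c}. f b)) =
      (\<Sum>c\<in>A. f a * (\<delta> (f c) * (\<Prod>b\<in>A - {c}. f b)))"
  proof (intro sum.cong refl)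
    fix c assume "c \<in> A"
    with insert have "insert a A - {c} = insert a (A - {c})" by auto
    then show "\<delta> (f c) * (\<Prod>b\<in>insert a A - {c}. f b) = f a * (\<delta> (f c) * (\<Prod>b\<in>A - {c}. f b))"
      using insert by (simp add: algebra_simps)
  qed
  then show ?case
    using insert by (simp add: \<delta>_leibniz sum_distrib_left)
qed

text \<open>The divided power \<open>x\<^sub>i\<^sup>k / (k! i!\<^sup>k)\<close>.\<close>
definition dp :: "nat \<Rightarrow> nat \<Rightarrow> 'a" where
  "dp i k = h (1 / (fact k * fact i ^ k)) * x i ^ k"

text \<open>The product of the divided powers with exponents \<open>l\<^sub>1, \<dots>, l\<^sub>N\<close>.\<close>
definition dp_monom :: "nat \<Rightarrow> (nat \<Rightarrow> nat) \<Rightarrow> 'a" where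
  "dp_monom N l = (\<Prod>i=1..N. dp i (l i))"

lemma dp_0 [simp]: "dp i 0 = 1"
  by (simp add: dp_def h_one)

lemma x_times_dp: "x i * dp i k = of_nat (fact i * Suc k) * dp i (Suc k)"
proof -
  have "1 / (fact k * fact i ^ k) =
      of_nat (fact i * Suc k) * (1 / (fact (Suc k) * fact i ^ Suc k) :: complex)"
    by (simp add: divide_simps del: of_nat_Suc) (simp add: algebra_simps)
  then have "h (1 / (fact k * fact i ^ k)) =
      of_nat (fact i * Suc k) * h (1 / (fact (Suc k) * fact i ^ Suc k))"
    by (simp only: h_mult h_of_nat)
  then show ?thesis
    by (simp only: dp_def power_Suc mult_ac)
qed

lemma \<delta>_dp_Suc:
  assumes "i \<ge> 1"
  shows "\<delta> (dp i (Suc k)) = h (1 / fact i) * dp i k * x (Suc i)"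
proof -
  have "of_nat (Suc k) * (1 / (fact (Suc k) * fact i ^ Suc k)) =
      1 / fact i * (1 / (fact k * fact i ^ k) :: complex)"
    by (simp add: divide_simps del: of_nat_Suc)
  then have *: "of_nat (Suc k) * h (1 / (fact (Suc k) * fact i ^ Suc k)) =
      h (1 / fact i) * h (1 / (fact k * fact i ^ k))"
    by (metis h_mult h_of_nat)
  have "\<delta> (dp i (Suc k)) =
      of_nat (Suc k) * h (1 / (fact (Suc k) * fact i ^ Suc k)) * x i ^ k * x (Suc i)"
    by (simp only: dp_def \<delta>_leibniz \<delta>_scalar \<delta>_power \<delta>_chain[OF assms] diff_Suc_1 mult_zero_left
        add_0_left add_0_right mult_ac)
  then show ?thesis
    by (simp only: * dp_def mult_ac)
qed

lemma \<delta>_dp_Suc_times_dp: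
  assumes "i \<ge> 1"
  shows "\<delta> (dp i (Suc k)) * dp (Suc i) j = of_nat (Suc i * Suc j) * (dp i k * dp (Suc i) (Suc j))"
proof -
  have "1 / fact i * of_nat (fact (Suc i) * Suc j) = (of_nat (Suc i * Suc j) :: complex)"
    by (simp add: field_simps)
  then have "h (1 / fact i) * of_nat (fact (Suc i) * Suc j) = of_nat (Suc i * Suc j)"
    by (metis h_mult h_of_nat)
  moreover have "\<delta> (dp i (Suc k)) * dp (Suc i) j =
      h (1 / fact i) * dp i k * (x (Suc i) * dp (Suc i) j)"
    by (simp only: \<delta>_dp_Suc[OF assms] mult_ac)
  then have "\<delta> (dp i (Suc k)) * dp (Suc i) j =
      h (1 / fact i) * of_nat (fact (Suc i) * Suc j) * (dp i k * dp (Suc i) (Suc j))"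
    by (simp only: x_times_dp mult_ac)
  ultimately show ?thesis by simp
qed

text \<open>Multiplication by \<open>x\<^sub>1\<close> raises the exponent of \<open>x\<^sub>1\<close> by one.\<close>
lemma x_times_dp_monom:
  fixes l :: "nat \<Rightarrow> nat"
  assumes "N \<ge> 1"
  defines "l' \<equiv> l(1 := Suc (l 1))"
  shows "x 1 * dp_monom N l = of_nat (l' 1) * dp_monom N l'"
proof -
  have split: "dp_monom N l = dp 1 (l 1) * (\<Prod>k\<in>{1..N} - {1}. dp k (l k))" for l
    unfolding dp_monom_def using assms(1) by (intro prod.remove) auto
  have rest: "(\<Prod>k\<in>{1..N} - {1}. dp k (l' k)) = (\<Prod>k\<in>{1..N} - {1}. dp k (l k))"
    by (intro prod.cong) (auto simp: l'_def)
  have "x 1 * dp_monom N l = x 1 * dp 1 (l 1) * (\<Prod>k\<in>{1..N} - {1}. dp k (l k))"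
    by (simp only: split mult_ac)
  also have "\<dots> = of_nat (l' 1) * (dp 1 (l' 1) * (\<Prod>k\<in>{1..N} - {1}. dp k (l' k)))"
    unfolding x_times_dp rest by (simp add: l'_def mult_ac)
  finally show ?thesis by (simp only: split)
qed

text \<open>
  Differentiating the factor of index \<open>i\<close> moves one unit of exponent from \<open>i\<close> to \<open>i + 1\<close>.
\<close>
lemma \<delta>_dp_monom_term:
  fixes l :: "nat \<Rightarrow> nat"
  assumes i: "i \<ge> 1" "Suc i \<le> N" and li: "l i > 0"
  defines "l' \<equiv> l(i := l i - 1, Suc i := Suc (l (Suc i)))"
  shows "\<delta> (dp i (l i)) * (\<Prod>k\<in>{1..N} - {i}. dp k (l k)) =
    of_nat (Suc i * l' (Suc i)) * dp_monom N l'"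
proof -
  obtain k where k: "l i = Suc k" using li by (cases "l i") auto
  let ?R = "{1..N} - {i} - {Suc i}"
  have split1: "(\<Prod>k\<in>{1..N} - {i}. dp k (l k)) = dp (Suc i) (l (Suc i)) * (\<Prod>k\<in>?R. dp k (l k))" for l
    using i by (intro prod.remove) auto
  have split2: "dp_monom N l = dp i (l i) * (dp (Suc i) (l (Suc i)) * (\<Prod>k\<in>?R. dp k (l k)))" for l
    unfolding split1[symmetric] dp_monom_def using i by (intro prod.remove) auto
  have rest: "(\<Prod>k\<in>?R. dp k (l' k)) = (\<Prod>k\<in>?R. dp k (l k))"
    by (intro prod.cong) (auto simp: l'_def)
  have l': "l' i = k" "l' (Suc i) = Suc (l (Suc i))"
    by (simp_all add: l'_def k)
  have "\<delta> (dp i (l i)) * (\<Prod>k\<in>{1..N} - {i}. dp k (l k)) =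
      \<delta> (dp i (Suc k)) * dp (Suc i) (l (Suc i)) * (\<Prod>k\<in>?R. dp k (l k))"
    by (simp only: split1 k mult_ac)
  also have "\<dots> = of_nat (Suc i * l' (Suc i)) * dp_monom N l'"
    unfolding \<delta>_dp_Suc_times_dp[OF i(1)] split2 rest l' by (simp only: mult_ac)
  finally show ?thesis .
qed

text \<open>
  The bijections reindex the contributions in which the exponent \<open>j\<close> has been raised, by the
  resulting exponent sequences.
\<close>
lemma dp_monom_sum_Suc:
  "x 1 * (\<Sum>l\<in>bell_indices m. dp_monom (Suc m) l) + \<delta> (\<Sum>l\<in>bell_indices m. dp_monom (Suc m) l) =
    of_nat (Suc m) * (\<Sum>l\<in>bell_indices (Suc m). dp_monom (Suc m) l)"
proof -
  let ?T = "dp_monom (Suc m)" and ?B = "bell_indices m" and ?B' = "bell_indices (Suc m)"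
  define c where "c j l = of_nat (j * l j) * ?T l" for j and l :: "nat \<Rightarrow> nat"
  have positive: "(\<Sum>l | l \<in> ?B' \<and> l j > 0. c j l) = (\<Sum>l\<in>?B'. c j l)" for j
    by (rule sum.mono_neutral_left) (auto simp: c_def finite_bell_indices)
  have first: "x 1 * (\<Sum>l\<in>?B. ?T l) = (\<Sum>l\<in>?B'. c 1 l)"
  proof -
    have "x 1 * (\<Sum>l\<in>?B. ?T l) = (\<Sum>l\<in>?B. c 1 (l(1 := Suc (l 1))))"
      unfolding sum_distrib_left c_def
      by (intro sum.cong refl) (subst x_times_dp_monom, simp_all)
    also have "\<dots> = (\<Sum>l | l \<in> ?B' \<and> l 1 > 0. c 1 l)"
      by (rule sum.reindex_bij_betw[OF bij_betw_bell_raise])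
    finally show ?thesis by (simp only: positive)
  qed
  have shift: "(\<Sum>l\<in>?B. \<delta> (dp i (l i)) * (\<Prod>k\<in>{1..Suc m} - {i}. dp k (l k))) = (\<Sum>l\<in>?B'. c (Suc i) l)"
    if i: "i \<in> {1..m}" for i
  proof -
    have "(\<Sum>l\<in>?B. \<delta> (dp i (l i)) * (\<Prod>k\<in>{1..Suc m} - {i}. dp k (l k))) =
        (\<Sum>l | l \<in> ?B \<and> l i > 0. \<delta> (dp i (l i)) * (\<Prod>k\<in>{1..Suc m} - {i}. dp k (l k)))"
      by (rule sum.mono_neutral_right) (auto simp: finite_bell_indices \<delta>_one)
    also have "\<dots> = (\<Sum>l | l \<in> ?B \<and> l i > 0. c (Suc i) (l(i := l i - 1, Suc i := Suc (l (Suc i)))))"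
      unfolding c_def using i by (intro sum.cong refl \<delta>_dp_monom_term) auto
    also have "\<dots> = (\<Sum>l | l \<in> ?B' \<and> l (Suc i) > 0. c (Suc i) l)"
      by (rule sum.reindex_bij_betw[OF bij_betw_bell_shift[OF i]])
    finally show ?thesis by (simp only: positive)
  qed
  have "\<delta> (\<Sum>l\<in>?B. ?T l) =
      (\<Sum>l\<in>?B. \<Sum>i=1..m. \<delta> (dp i (l i)) * (\<Prod>k\<in>{1..Suc m} - {i}. dp k (l k)))"
    unfolding \<delta>_sum
  proof (intro sum.cong refl)
    fix l assume "l \<in> ?B"
    \<comment> \<open>the factor with index \<open>m + 1\<close> is 1, so its derivative drops out\<close>
    then have "l (Suc m) = 0" by (auto simp: bell_indices_def)
    then show "\<delta> (?T l) = (\<Sum>i=1..m. \<delta> (dp i (l i)) * (\<Prod>k\<in>{1..Suc m} - {i}. dp k (l k)))"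
      unfolding dp_monom_def by (subst \<delta>_prod) (simp_all add: \<delta>_one)
  qed
  also have "\<dots> = (\<Sum>i=1..m. \<Sum>l\<in>?B'. c (Suc i) l)"
    by (subst sum.swap) (rule sum.cong[OF refl shift])
  finally have "x 1 * (\<Sum>l\<in>?B. ?T l) + \<delta> (\<Sum>l\<in>?B. ?T l) = (\<Sum>j=1..Suc m. \<Sum>l\<in>?B'. c j l)"
    using first sum.atLeast_Suc_atMost[of 1 "Suc m" "\<lambda>j. \<Sum>l\<in>?B'. c j l"]
      sum.shift_bounds_cl_Suc_ivl[of "\<lambda>j. \<Sum>l\<in>?B'. c j l" 1 m] by simp
  also have "\<dots> = (\<Sum>l\<in>?B'. of_nat (\<Sum>j=1..Suc m. j * l j) * ?T l)"
    unfolding c_def by (subst sum.swap) (simp only: of_nat_sum sum_distrib_right)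
  also have "\<dots> = of_nat (Suc m) * (\<Sum>l\<in>?B'. ?T l)"
    unfolding sum_distrib_left by (intro sum.cong refl) (simp add: bell_indices_def del: sum.cl_ivl_Suc)
  finally show ?thesis .
qed

lemma bell_eq_dp_monom:
  assumes "m \<le> N"
  shows "bell (\<lambda>c p. h c * p) m x = h (fact m) * (\<Sum>l\<in>bell_indices m. dp_monom N l)"
  unfolding bell_def sum_distrib_left
proof (intro sum.cong refl)
  fix l assume l: "l \<in> bell_indices m"
  have h_prod: "h (\<Prod>i\<in>A. f i) = (\<Prod>i\<in>A. h (f i))" for f and A :: "nat set"
    by (induction A rule: infinite_finite_induct) (simp_all add: h_one h_mult)
  have "dp_monom N l = (\<Prod>i=1..m. dp i (l i))"
    unfolding dp_monom_def using l assms
    by (intro prod.mono_neutral_right) (auto simp: bell_indices_def)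
  also have "\<dots> = h (1 / ((\<Prod>i=1..m. fact (l i)) * (\<Prod>i=1..m. fact i ^ l i))) * (\<Prod>i=1..m. x i ^ l i)"
    by (simp only: dp_def prod.distrib h_prod[symmetric] prod_dividef prod.neutral_const)
  finally show "h (fact m / ((\<Prod>i=1..m. fact (l i)) * (\<Prod>i=1..m. fact i ^ l i))) * (\<Prod>i=1..m. x i ^ l i) =
      h (fact m) * dp_monom N l"
    by (simp add: h_mult[symmetric] mult.assoc[symmetric])
qed

lemma bell_0: "bell (\<lambda>c p. h c * p) 0 x = 1"
proof -
  have "bell_indices 0 = {\<lambda>i. 0}" by (auto simp: bell_indices_def)
  then show ?thesis by (simp add: bell_def h_one)
qed

lemma bell_Suc:
  "bell (\<lambda>c p. h c * p) (Suc m) x =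
    x 1 * bell (\<lambda>c p. h c * p) m x + \<delta> (bell (\<lambda>c p. h c * p) m x)"
proof -
  let ?S = "\<Sum>l\<in>bell_indices m. dp_monom (Suc m) l"
  have fact: "h (fact (Suc m)) = h (fact m) * of_nat (Suc m)"
    using h_mult[of "fact m" "of_nat (Suc m)"] by (simp only: h_of_nat fact_Suc mult.commute)
  have "bell (\<lambda>c p. h c * p) (Suc m) x = h (fact m) * (x 1 * ?S + \<delta> ?S)"
    unfolding dp_monom_sum_Suc by (simp only: bell_eq_dp_monom[OF order_refl] fact mult.assoc)
  also have "\<dots> = x 1 * (h (fact m) * ?S) + \<delta> (h (fact m) * ?S)"
    by (simp add: \<delta>_leibniz \<delta>_scalar algebra_simps)
  finally show ?thesis
    by (simp add: bell_eq_dp_monom[of m "Suc m"])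
qed

end

section \<open>Operators of first order\<close>

context comm_diff_algebra
begin

lemma D_add: "D i (u + v) = D i u + D i v"
  proof -
  interpret Vector_Spaces.linear scale scale "D i" by (rule D_linear)
  show ?thesis by (rule add)
qed

lemma D_one: "D i 1 = 0"
  using D_leibniz[of i 1 1] by simp

lemma D_scale: "D i (scale c v) = scale c (D i v)"
  proof -
  interpret Vector_Spaces.linear scale scale "D i" by (rule D_linear)
  show ?thesis by (rule scale)
qed

lemma dpow_add: "dpow D \<alpha> (u + v) = dpow D \<alpha> u + dpow D \<alpha> v"
proof -
  obtain ns :: "'n list" where ns: "set ns = UNIV" "distinct ns"
    using finite_distinct_list[OF finite_UNIV] by blast
  have "(D i ^^ k) (u + v) = (D i ^^ k) u + (D i ^^ k) v" for i k u v
    by (induction k) (simp_all add: D_add)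
  then have "List.fold (\<lambda>i. D i ^^ \<alpha> i) js (u + v) =
      List.fold (\<lambda>i. D i ^^ \<alpha> i) js u + List.fold (\<lambda>i. D i ^^ \<alpha> i) js v" for js
    by (induction js arbitrary: u v) auto
  then show ?thesis
    by (simp add: dpow_eq_fold_list[OF ns(2,1)])
qed

lemma dpow_0_index: "dpow D 0 v = v"
proof -
  obtain ns :: "'n list" where ns: "set ns = UNIV" "distinct ns"
    using finite_distinct_list[OF finite_UNIV] by blast
  have "List.fold (\<lambda>i. D i ^^ (0 :: 'n \<Rightarrow> nat) i) js v = v" for js
    by (induction js) auto
  then show ?thesis
    by (simp add: dpow_eq_fold_list[OF ns(2,1)])
qed

lemma dpow_unit_index_add: "dpow D (unit_index i + \<alpha>) v = D i (dpow D \<alpha> v)"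
proof -
  have pull: "dpow D \<beta> v = (D i ^^ \<beta> i) (Finite_Set.fold (\<lambda>j. D j ^^ \<beta> j) v (UNIV - {i}))" for \<beta>
  proof -
    interpret comp_fun_commute "\<lambda>j. D j ^^ \<beta> j"
      by (rule comp_fun_commute_funpow_D)
    show ?thesis unfolding dpow_def by (rule fold_rec) auto
  qed
  have "Finite_Set.fold (\<lambda>j. D j ^^ (unit_index i + \<alpha>) j) v (UNIV - {i}) =
      Finite_Set.fold (\<lambda>j. D j ^^ \<alpha> j) v (UNIV - {i})"
    by (rule Finite_Set.fold_cong[where S = UNIV])
      (auto intro!: comp_fun_commute_on.intro simp: fun_eq_iff funpow_D_commute unit_index_def)
  then show ?thesis
    unfolding pull by (simp add: unit_index_def)
qed

lemma dpow_unit_index: "dpow D (unit_index i) v = D i v"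
  using dpow_unit_index_add[of i 0 v] by (simp add: dpow_0_index)

lemma dcirc_add_left: "dcirc D (P + P') Q = dcirc D P Q + dcirc D P' Q"
  unfolding dcirc_def
  by (rule setsum_keys_plus_distrib)
    (simp_all add: distrib_right single_add sum.distrib)

lemma dcirc_add_right: "dcirc D P (Q + Q') = dcirc D P Q + dcirc D P Q'"
  unfolding dcirc_def sum.distrib[symmetric]
  by (intro sum.cong refl setsum_keys_plus_distrib)
    (simp_all add: dpow_add distrib_left single_add)

lemma dcomp_add_left: "dcomp D (P + P') Q = dcomp D P Q + dcomp D P' Q"
  unfolding dcomp_def
  by (rule setsum_keys_plus_distrib)
    (simp_all add: distrib_right distrib_left single_add sum.distrib)

lemma dcomp_add_right: "dcomp D P (Q + Q') = dcomp D P Q + dcomp D P Q'"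
  unfolding dcomp_def sum.distrib[symmetric]
  by (intro sum.cong refl setsum_keys_plus_distrib)
    (simp_all add: dpow_add distrib_left single_add sum.distrib)

lemma dcirc_zero_left [simp]: "dcirc D 0 Q = 0"
  and dcomp_zero_left [simp]: "dcomp D 0 Q = 0"
  by (simp_all add: dcirc_def dcomp_def)

lemma Vect_induct [consumes 1, case_names zero single add]:
  assumes "L \<in> Vect"
    and zero: "P 0"
    and single: "\<And>i u. P (Poly_Mapping.single (unit_index i) u)"
    and add: "\<And>L L'. P L \<Longrightarrow> P L' \<Longrightarrow> P (L + L')"
  shows "P (L :: ('n, 'u) diffop)"
proof -
  obtain u :: "'n \<Rightarrow> 'u" where L: "L = (\<Sum>i\<in>UNIV. Poly_Mapping.single (unit_index i) (u i))"
    using assms(1) by (auto simp: Vect_def)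
  have "P (\<Sum>i\<in>A. Poly_Mapping.single (unit_index i) (u i))" if "finite A" for A
    using that by (induction A rule: finite_induct) (auto intro: zero single add)
  then show ?thesis by (simp add: L)
qed

lemma diffop_induct [case_names single add]:
  assumes single: "\<And>\<alpha> u. P (Poly_Mapping.single \<alpha> u)"
    and add: "\<And>R R'. P R \<Longrightarrow> P R' \<Longrightarrow> P (R + R')"
  shows "P (R :: ('n, 'u) diffop)"
proof (induction R rule: update_induct)
  case const
  \<comment> \<open>the zero operator, written as a symbol with coefficient 0\<close>
  show ?case using single[of undefined 0] by simp
next
  case (update f a b)
  then have "Poly_Mapping.update a b f = Poly_Mapping.single a b + f"
    by (intro poly_mapping_eqI)
      (auto simp: lookup_update lookup_add lookup_single when_def in_keys_iff)
  then show ?case using add[OF single update.IH] by simp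
qed

lemma le_unit_index: "{\<gamma>. \<gamma> \<le> unit_index i} = {0, unit_index i :: 'n \<Rightarrow> nat}"
proof (intro equalityI subsetI)
  fix \<gamma> :: "'n \<Rightarrow> nat" assume "\<gamma> \<in> {\<gamma>. \<gamma> \<le> unit_index i}"
  then have le: "\<gamma> j \<le> (if j = i then 1 else 0)" for j
    by (simp add: le_fun_def unit_index_def)
  have off: "\<gamma> j = 0" if "j \<noteq> i" for j using le[of j] that by simp
  have "\<gamma> i = 0 \<or> \<gamma> i = 1" using le[of i] by auto
  then show "\<gamma> \<in> {0, unit_index i}"
    using off by (auto simp: fun_eq_iff unit_index_def) metis
qed (auto simp: le_fun_def)

lemma dcirc_unit_single:
  "dcirc D (Poly_Mapping.single (unit_index i) u) (Poly_Mapping.single \<beta> v) =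
    Poly_Mapping.single \<beta> (u * D i v)"
  by (simp add: dcirc_single dpow_unit_index)

lemma dcomp_unit_single:
  "dcomp D (Poly_Mapping.single (unit_index i) u) (Poly_Mapping.single \<beta> v) =
    Poly_Mapping.single (unit_index i + \<beta>) (u * v) + Poly_Mapping.single \<beta> (u * D i v)"
proof -
  have "unit_index i \<noteq> (0 :: 'n \<Rightarrow> nat)"
    by (auto simp: unit_index_def fun_eq_iff)
  then show ?thesis
    by (simp add: dcomp_single le_unit_index multi_binomial_def dpow_unit_index dpow_0_index
        add.commute[of "unit_index i"])
qed

lemma dcomp_Vect:
  assumes "L \<in> Vect"
  shows "dcomp D L P = L * P + dcirc D L P"
  using assms
proof (induction L rule: Vect_induct)
  case (single i u)
  show ?case
    by (induction P rule: diffop_induct)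
      (simp_all add: dcomp_unit_single dcirc_unit_single mult_single
        dcomp_add_right dcirc_add_right distrib_left add_ac)
qed (simp_all add: dcomp_add_left dcirc_add_left distrib_right add_ac)

lemma dcirc_Vect_leibniz:
  assumes "L \<in> Vect"
  shows "dcirc D L (P * Q) = dcirc D L P * Q + P * dcirc D L Q"
  using assms
proof (induction L rule: Vect_induct)
  case (single i u)
  show ?case
  proof (induction P rule: diffop_induct)
    case (single \<alpha> v)
    show ?case
      by (induction Q rule: diffop_induct)
        (simp_all add: dcirc_unit_single mult_single D_leibniz dcirc_add_right distrib_left
          single_add[symmetric] algebra_simps)
  qed (simp_all add: dcirc_add_right algebra_simps)
qed (simp_all add: dcirc_add_left algebra_simps)

lemma dcirc_dcomp_Vect:
  assumes "L \<in> Vect"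
  shows "dcirc D (dcomp D L P) Q = dcirc D L (dcirc D P Q)"
  using assms
proof (induction L rule: Vect_induct)
  case (single i u)
  show ?case
  proof (induction P rule: diffop_induct)
    case (single \<alpha> w)
    show ?case
      by (induction Q rule: diffop_induct)
        (simp_all add: dcomp_unit_single dcirc_unit_single dcirc_single dcirc_add_left
          dcirc_add_right dpow_unit_index dpow_unit_index_add D_leibniz single_add[symmetric]
          distrib_left mult_ac
          add.commute[where 'a = 'u])
  qed (simp_all add: dcomp_add_right dcirc_add_left dcirc_add_right)
qed (simp_all add: dcomp_add_left dcirc_add_left)

lemma dcirc_one: "dcirc D 1 Q = Q"
  by (induction Q rule: diffop_induct)
    (simp_all add: dcirc_add_right dcirc_single dpow_0_index flip: single_one)

lemma diffop_scale_eq_mult: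
  "diffop_scale scale c P = Poly_Mapping.single 0 (scale c 1) * P"
proof -
  have scale: "scale c = (*) (scale c 1)"
    by (rule ext) (simp flip: scale_mult_left)
  show ?thesis
    unfolding diffop_scale_def by (subst scale) (rule mult_map_scale_conv_mult)
qed

text \<open>The scalar \<open>c\<close> is embedded in the algebra of operators as \<open>(c 1) \<partial>\<^sup>0\<close>.\<close>
lemma derivation_chain_Vect:
  fixes L :: "('n, 'u) diffop"
  assumes L: "L \<in> Vect"
  shows "derivation_chain (\<lambda>c. Poly_Mapping.single 0 (scale c 1)) (dcirc D L)
    (\<lambda>i. dcirc D (dcomp_power D L (i - 1)) L)"
proof
  show "dcirc D L (Poly_Mapping.single 0 (scale c 1)) = 0" for c
    using L
    by (induction L rule: Vect_induct)
      (simp_all add: dcirc_unit_single D_scale D_one dcirc_add_left)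
  show "dcirc D L (dcirc D (dcomp_power D L (i - 1)) L) =
      dcirc D (dcomp_power D L (Suc i - 1)) L" if "i \<ge> 1" for i
    using that by (cases i) (simp_all add: dcomp_power_def dcirc_dcomp_Vect[OF L])
  show "Poly_Mapping.single 0 (scale (a * b) 1) =
      (Poly_Mapping.single 0 (scale a 1) * Poly_Mapping.single 0 (scale b 1) :: ('n, 'u) diffop)" for a b
    using scale_mult_left[of a 1 "scale b 1"] by (simp add: mult_single)
qed (simp_all add: scale_left_distrib single_add dcirc_add_right dcirc_Vect_leibniz[OF L])

lemma dcomp_power_Vect:
  assumes L: "L \<in> Vect"
  shows "dcomp_power D L m =
    bell (diffop_scale scale) m (\<lambda>i. dcirc D (dcomp_power D L (i - 1)) L)"
proof -
  interpret derivation_chain "\<lambda>c. Poly_Mapping.single 0 (scale c 1)" "dcirc D L"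
    "\<lambda>i. dcirc D (dcomp_power D L (i - 1)) L"
    by (rule derivation_chain_Vect[OF L])
  have scale: "diffop_scale scale = (\<lambda>c p. Poly_Mapping.single 0 (scale c 1) * p)"
    by (simp add: fun_eq_iff diffop_scale_eq_mult)
  show ?thesis
    unfolding scale
  proof (induction m)
    case 0
    show ?case unfolding bell_0 by (simp add: dcomp_power_def)
  next
    case (Suc m)
    have first: "dcirc D (dcomp_power D L (1 - 1)) L = L"
      by (simp add: dcomp_power_def dcirc_one)
    have "dcomp_power D L (Suc m) = L * dcomp_power D L m + dcirc D L (dcomp_power D L m)"
      using dcomp_Vect[OF L] by (simp add: dcomp_power_def)
    then show ?case
      unfolding bell_Suc first Suc.IH[symmetric] .
  qed
qed

end

theorem theorem5:
  fixes scale :: "complex \<Rightarrow> 'u::comm_ring_1 \<Rightarrow> 'u"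
    and D :: "'n::finite \<Rightarrow> 'u \<Rightarrow> 'u"
    and L :: "('n, 'u) diffop"
    and m :: nat
  assumes "comm_diff_algebra scale D"
    and "L \<in> Vect"
  shows "dcomp_power D L m =
    bell (diffop_scale scale) m (\<lambda>i. dcirc D (dcomp_power D L (i - 1)) L)"
  using comm_diff_algebra.dcomp_power_Vect[OF assms] .

end
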